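(* Let $\mathcal T:\mathbb{R}^m\to\mathbb{R}^m$ be a deep OptEq operator that is nonexpansive, and let $\mathcal R_z:\mathbb{R}^m\to\mathbb{R}$ be a differentiable convex function whose gradient $\nabla\mathcal R_z$ is $L_z$-Lipschitz, with $L_z>0$. Let $\gamma=\frac1{2L_z}$. Suppose that there is a constant $B_1^*$ such that for any $\beta\in[0,\frac12]$ and $\lambda\in[0,\frac{L_z}2]$, every solution $\mathbf z$ of $$\mathbf z=\beta\bigl(\mathbf z-\gamma(\nabla\mathcal R_z(\mathbf z)+\lambda\mathbf z)\bigr)+(1-\beta)\mathcal T(\mathbf z)$$ satisfies $\|\mathbf z\|\le B_1^*$. Suppose that $\mathcal R_z$ has a unique minimizer $\bar{\mathbf z}$ on $\operatorname{Fix}(\mathcal T)$. Let $\beta_k=\frac{\eta}{k^\rho}$ and $\lambda_k=\frac{\eta}{k^c}$ for $k\ge1$, where $\rho,c>0$, $\rho+2c<1$ and $\eta=\min\{\sqrt{2L_z},\frac{L_z}2,\frac12\}$. Then, from any starting point $\mathbf z^0\in\mathbb{R}^m$, the sequence generated by $$\mathbf z^k=\beta_k\bigl((1-\gamma\lambda_k)\mathbf z^{k-1}-\gamma\nabla\mathcal R_z(\mathbf z^{k-1})\bigr)+(1-\beta_k)\mathcal T(\mathbf z^{k-1}),\qquad k\ge1,$$ converges to $\bar{\mathbf z}$.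
   Context: A deep OptEq operator is a map $\mathcal T=f_L\circ\cdots\circ f_1$ on $\mathbb{R}^m$, where $f_l(\mathbf z)=\alpha\mathbf W_l^\top\sigma(\mathbf W_l\mathbf z+\mathbf U_l\mathbf x+\mathbf b_l)+(1-\alpha)\mathbf z$, with $\alpha\in(0,1]$, $\sigma:\mathbb{R}\to\mathbb{R}$ an activation function applied element-wise, $\mathbf W_l\in\mathbb{R}^{n_l\times m}$, $\mathbf U_l\in\mathbb{R}^{n_l\times d}$, $\mathbf b_l\in\mathbb{R}^{n_l}$ and a fixed $\mathbf x\in\mathbb{R}^d$. Nonexpansive means $\|\mathcal T(\mathbf z)-\mathcal T(\mathbf z')\|\le\|\mathbf z-\mathbf z'\|$ for all $\mathbf z,\mathbf z'$ (it holds, for instance, if $\sigma$ is nondecreasing and $1$-Lipschitz and all $\|\mathbf W_l\|_2\le1$). $\operatorname{Fix}(\mathcal T)=\{\mathbf z:\mathcal T(\mathbf z)=\mathbf z\}$, and $\|\cdot\|$ is the Euclidean norm. *)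

theory Defs
  imports "HOL-Analysis.Analysis"
begin

text \<open>
  The layers have \<^emph>\<open>different\<close> widths \<open>n\<^sub>l\<close>, so the width is a natural number and the weights are given
  by their rows: \<open>W i\<close>, \<open>U i\<close>, \<open>b i\<close> for \<open>i < n\<close> are the \<open>i\<close>-th rows of \<open>W\<close>, \<open>U\<close>, \<open>b\<close> (values at
  \<open>i \<ge> n\<close> are irrelevant). Thus \<open>W z\<close> has entries \<open>W i \<bullet> z\<close>, and \<open>W\<^sup>T v\<close> is the combination
  \<open>\<Sum>i<n. v i *\<^sub>R W i\<close> of the rows.
\<close>

definition opteq_layer ::
  "real \<Rightarrow> (real \<Rightarrow> real) \<Rightarrow> nat \<Rightarrow> (nat \<Rightarrow> real ^ 'm) \<Rightarrow> (nat \<Rightarrow> real ^ 'd) \<Rightarrow> (nat \<Rightarrow> real) \<Rightarrow>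
    real ^ 'd \<Rightarrow> real ^ 'm \<Rightarrow> real ^ 'm"
  where "opteq_layer \<alpha> \<sigma> n W U b x z =
    \<alpha> *\<^sub>R (\<Sum>i<n. \<sigma> (W i \<bullet> z + U i \<bullet> x + b i) *\<^sub>R W i) + (1 - \<alpha>) *\<^sub>R z"

text \<open>For weights given as matrices over a finite index type, enumerated by \<open>e\<close>:\<close>

lemma opteq_layer_matrix:
  fixes W :: "real ^ 'm ^ 'n" and U :: "real ^ 'd ^ 'n" and b :: "real ^ 'n"
  assumes "bij_betw e {..<n} UNIV"
  shows "opteq_layer \<alpha> \<sigma> n (\<lambda>i. W $ e i) (\<lambda>i. U $ e i) (\<lambda>i. b $ e i) x z =
    \<alpha> *\<^sub>R (transpose W *v (\<chi> j. \<sigma> ((W *v z + U *v x + b) $ j))) + (1 - \<alpha>) *\<^sub>R z"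
proof -
  have "(\<Sum>i<n. \<sigma> (W $ e i \<bullet> z + U $ e i \<bullet> x + b $ e i) *\<^sub>R W $ e i) =
      (\<Sum>j\<in>UNIV. \<sigma> (W $ j \<bullet> z + U $ j \<bullet> x + b $ j) *\<^sub>R W $ j)"
    by (rule sum.reindex_bij_betw [OF assms])
  also have "\<dots> = transpose W *v (\<chi> j. \<sigma> ((W *v z + U *v x + b) $ j))"
    by (simp add: vec_eq_iff matrix_vector_mult_def transpose_def inner_vec_def mult.commute)
  finally show ?thesis
    by (simp add: opteq_layer_def)
qed

text \<open>The composition \<open>f\<^sub>L \<circ> \<dots> \<circ> f\<^sub>1\<close>; layers are numbered from 1.\<close>

primrec deep_opteq ::
  "real \<Rightarrow> (real \<Rightarrow> real) \<Rightarrow> (nat \<Rightarrow> nat) \<Rightarrow> (nat \<Rightarrow> nat \<Rightarrow> real ^ 'm) \<Rightarrow> (nat \<Rightarrow> nat \<Rightarrow> real ^ 'd) \<Rightarrow>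
    (nat \<Rightarrow> nat \<Rightarrow> real) \<Rightarrow> real ^ 'd \<Rightarrow> nat \<Rightarrow> real ^ 'm \<Rightarrow> real ^ 'm"
  where
    "deep_opteq \<alpha> \<sigma> n W U b x 0 = id"
  | "deep_opteq \<alpha> \<sigma> n W U b x (Suc l) =
      opteq_layer \<alpha> \<sigma> (n (Suc l)) (W (Suc l)) (U (Suc l)) (b (Suc l)) x \<circ> deep_opteq \<alpha> \<sigma> n W U b x l"

definition Fix :: "('a \<Rightarrow> 'a) \<Rightarrow> 'a set"
  where "Fix T = {z. T z = z}"

definition nonexpansive :: "('a::real_normed_vector \<Rightarrow> 'a) \<Rightarrow> bool"
  where "nonexpansive T \<longleftrightarrow> (\<forall>z z'. norm (T z - T z') \<le> norm (z - z'))"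

end

theory Submission
  imports Defs "HOL-Real_Asymp.Real_Asymp"
begin

text \<open>
  The \<open>k\<close>-th iteration map is a \<open>(1 - q\<^sub>k)\<close>-contraction with \<open>q\<^sub>k = \<beta>\<^sub>k \<gamma> \<lambda>\<^sub>k\<close>; let \<open>u\<^sub>k\<close> be its fixed
  point. By monotonicity of \<open>I - T\<close>, each cluster point of the bounded sequence \<open>u\<close> minimizes \<open>R\<close> on
  the fixed points of \<open>T\<close>, so \<open>u\<close> converges to the unique minimizer. Moreover \<open>u\<^sub>k - u\<^sub>k\<^sub>+\<^sub>1\<close> is of order
  \<open>k powr (c - 1)\<close> and \<open>q\<^sub>k\<close> of order \<open>k powr - (\<rho> + c)\<close>; since \<open>\<rho> + 2 * c < 1\<close>, the drift of the
  fixed points is negligible against \<open>q\<^sub>k\<close>, whose sum diverges, and the iterates track \<open>u\<close>.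
\<close>

section \<open>Cluster points and perturbed contractive recursions\<close>

text \<open>Otherwise some subsequence stays at a fixed distance from \<open>l0\<close>. Being
  bounded, it has a convergent subsequence of its own, whose limit cannot be
  \<open>l0\<close>.\<close>

lemma bounded_unique_cluster_point_imp_tendsto:
  fixes u :: "nat \<Rightarrow> 'a::heine_borel"
  assumes bounded: "bounded (range u)"
    and unique: "\<And>r l. strict_mono r \<Longrightarrow> (u \<circ> r) \<longlonglongrightarrow> l \<Longrightarrow> l = l0"
  shows "u \<longlonglongrightarrow> l0"
proof (rule ccontr)
  assume "\<not> u \<longlonglongrightarrow> l0"
  then obtain e where "e > 0" and "\<not> (\<forall>\<^sub>F k in sequentially. dist (u k) l0 < e)"
    by (auto simp: tendsto_iff)
  then have "\<exists>\<^sub>F k in sequentially. \<not> dist (u k) l0 < e"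
    by (simp add: frequently_def)
  then have inf: "infinite {k. \<not> dist (u k) l0 < e}"
    by (simp add: cofinite_eq_sequentially [symmetric] frequently_cofinite)
  define r where "r = enumerate {k. \<not> dist (u k) l0 < e}"
  have r: "strict_mono r"
    unfolding r_def using inf by (rule strict_mono_enumerate)
  have far: "\<not> dist (u (r k)) l0 < e" for k
    using enumerate_in_set [OF inf, of k] by (simp add: r_def)
  have "bounded (range (u \<circ> r))"
    using bounded by (rule bounded_subset) auto
  then obtain l s where s: "strict_mono s" and lim: "((u \<circ> r) \<circ> s) \<longlonglongrightarrow> l"
    using bounded_imp_convergent_subsequence by blast
  have "l = l0"
    using unique [of "r \<circ> s" l] strict_mono_o [OF r s] lim by (simp add: comp_assoc)
  then have "\<forall>\<^sub>F k in sequentially. dist (u (r (s k))) l0 < e"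
    using tendstoD [OF lim \<open>e > 0\<close>] by simp
  then show False
    using far by simp
qed

text \<open>Once \<open>d k \<le> e / 2 * q k\<close>, the excess of \<open>a\<close> over
  \<open>e / 2\<close> is governed by the factors \<open>1 - q k \<le> exp (- q k)\<close>. Their
  product is at most the exponential of minus a partial sum of \<open>q\<close>, and these sums
  diverge.\<close>

lemma perturbed_contraction_tendsto_0:
  fixes a q d :: "nat \<Rightarrow> real"
  assumes a: "\<And>k. 0 \<le> a k" and q: "\<And>k. 0 < q k" "\<And>k. q k \<le> 1"
    and div: "\<not> summable q"
    and d: "(\<lambda>k. d k / q k) \<longlonglongrightarrow> 0"
    and step: "\<And>k. a (Suc k) \<le> (1 - q k) * a k + d k"
  shows "a \<longlonglongrightarrow> 0"
proof (rule LIMSEQ_I)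
  fix e :: real
  assume "0 < e"
  then have e: "0 < e / 2" by simp
  then obtain N where N: "\<And>k. k \<ge> N \<Longrightarrow> d k / q k < e / 2"
    using order_tendstoD(2) [OF d e] by (auto simp: eventually_sequentially)
  have d_le: "d k \<le> e / 2 * q k" if "k \<ge> N" for k
    using N [OF that] q(1) [of k] by (simp add: field_simps)
  define s where "s m = (\<Sum>i<m. q (i + N))" for m
  \<comment> \<open>The number \<open>e / 2\<close> is the fixed point of
    \<open>a \<mapsto> (1 - q) * a + e / 2 * q\<close>, which is why subtracting it removes the
    perturbation. The absolute value makes the right-hand side nonnegative, so that
    \<open>1 - q\<close> may be replaced by the larger \<open>exp (- q)\<close>.\<close>
  have decay: "a (m + N) - e / 2 \<le> exp (- s m) * \<bar>a N - e / 2\<bar>" for m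
  proof (induction m)
    case 0
    then show ?case by (simp add: s_def)
  next
    case (Suc m)
    have "a (Suc m + N) - e / 2 \<le> (1 - q (m + N)) * (a (m + N) - e / 2)"
      using step [of "m + N"] d_le [of "m + N"] by (simp add: algebra_simps)
    also have "\<dots> \<le> (1 - q (m + N)) * (exp (- s m) * \<bar>a N - e / 2\<bar>)"
      by (intro mult_left_mono Suc.IH) (simp add: q)
    also have "\<dots> \<le> exp (- q (m + N)) * (exp (- s m) * \<bar>a N - e / 2\<bar>)"
      using exp_ge_add_one_self [of "- q (m + N)"] by (intro mult_right_mono) auto
    also have "\<dots> = exp (- s (Suc m)) * \<bar>a N - e / 2\<bar>"
      by (simp add: s_def exp_diff exp_minus exp_add field_simps)
    finally show ?case .
  qed
  have "filterlim s at_top sequentially"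
    unfolding filterlim_at_top
  proof
    fix Z
    have "\<not> (\<forall>m. s m \<le> Z)"
    proof
      assume "\<forall>m. s m \<le> Z"
      then have "summable (\<lambda>i. q (i + N))"
        by (intro summableI_nonneg_bounded [where x = Z]) (auto simp: s_def q less_imp_le)
      then show False
        using div by (simp add: summable_iff_shift)
    qed
    then obtain m where "Z < s m"
      by (auto simp: not_le)
    moreover have "s m \<le> s m'" if "m \<le> m'" for m'
      unfolding s_def using that by (intro sum_mono2) (auto simp: q less_imp_le)
    ultimately show "\<forall>\<^sub>F m in sequentially. Z \<le> s m"
      unfolding eventually_sequentially by (meson less_imp_le order_trans)
  qed
  then have "(\<lambda>m. exp (- s m)) \<longlonglongrightarrow> 0"
    by (intro filterlim_compose [OF exp_at_bot]) (simp add: filterlim_uminus_at_bot)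
  then have "(\<lambda>m. exp (- s m) * \<bar>a N - e / 2\<bar>) \<longlonglongrightarrow> 0"
    by (rule tendsto_mult_left_zero)
  from order_tendstoD(2) [OF this e] have "\<forall>\<^sub>F m in sequentially. a (m + N) < e"
    by eventually_elim (use decay in \<open>smt (verit) field_sum_of_halves\<close>)
  then have "\<forall>\<^sub>F m in sequentially. a m < e"
    by (rule eventually_sequentially_seg [THEN iffD1])
  then show "\<exists>no. \<forall>k\<ge>no. norm (a k - 0) < e"
    using a by (simp add: eventually_sequentially)
qed

section \<open>Differences and sums of inverse powers\<close>

text \<open>After factoring out \<open>1 / y powr a\<close>, this is the Bernoulli-type bound
  \<open>1 - a / y \<le> (1 + 1 / y) powr (- a)\<close>, which follows from
  \<open>ln (1 + t) \<le> t\<close> and \<open>1 + t \<le> exp t\<close>.\<close>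

lemma inverse_powr_difference_le:
  fixes a y :: real
  assumes "0 \<le> a" "0 < y"
  shows "1 / y powr a - 1 / (y + 1) powr a \<le> a / y powr (a + 1)"
proof -
  have "ln (1 + 1 / y) \<le> 1 / y"
    using assms by (intro ln_add_one_self_le_self) simp
  then have "1 - a / y \<le> 1 + - a * ln (1 + 1 / y)"
    using mult_left_mono [of "ln (1 + 1 / y)" "1 / y" a] assms by simp
  also have "\<dots> \<le> exp (- a * ln (1 + 1 / y))"
    by (rule exp_ge_add_one_self)
  also have "\<dots> = (1 + 1 / y) powr (- a)"
    using assms add_pos_pos [of 1 "1 / y"] by (simp add: powr_def)
  also have "1 + 1 / y = (y + 1) / y"
    using assms by (simp add: field_simps)
  also have "((y + 1) / y) powr (- a) = y powr a / (y + 1) powr a"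
    using assms by (simp add: powr_divide powr_minus field_simps)
  finally have "1 / y powr a * (1 - a / y) \<le> 1 / y powr a * (y powr a / (y + 1) powr a)"
    using assms by (intro mult_left_mono) auto
  then show ?thesis
    using assms by (simp add: powr_add right_diff_distrib)
qed

text \<open>The difference has order \<open>k powr - (a + 1)\<close>, so a weight
  \<open>k powr s\<close> with \<open>s < a + 1\<close> cannot compensate for it. The weight will be
  the growth of \<open>1 / (q k)\<^sup>2\<close> in the drift estimate.\<close>

lemma powr_difference_tendsto_0:
  fixes a s :: real
  assumes "0 \<le> a" "s < a + 1"
  shows "(\<lambda>k. (1 / real (Suc k) powr a - 1 / real (Suc (Suc k)) powr a) * real (Suc k) powr s)
    \<longlonglongrightarrow> 0"
proof (rule tendsto_sandwich [OF _ _ tendsto_const])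
  have "0 \<le> 1 / real (Suc k) powr a - 1 / real (Suc (Suc k)) powr a" for k
    using assms by (auto intro!: divide_left_mono powr_mono2)
  then show "\<forall>\<^sub>F k in sequentially. 0 \<le>
      (1 / real (Suc k) powr a - 1 / real (Suc (Suc k)) powr a) * real (Suc k) powr s"
    by (intro always_eventually allI mult_nonneg_nonneg) auto
  have "(1 / real (Suc k) powr a - 1 / real (Suc (Suc k)) powr a) * real (Suc k) powr s
      \<le> a * real (Suc k) powr (s - (a + 1))" for k
  proof -
    have "1 / real (Suc k) powr a - 1 / real (Suc (Suc k)) powr a \<le> a / real (Suc k) powr (a + 1)"
      using inverse_powr_difference_le [of a "real (Suc k)"] assms by (simp add: add.commute)
    from mult_right_mono [OF this, of "real (Suc k) powr s"] show ?thesis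
      by (simp add: powr_diff)
  qed
  then show "\<forall>\<^sub>F k in sequentially.
      (1 / real (Suc k) powr a - 1 / real (Suc (Suc k)) powr a) * real (Suc k) powr s
      \<le> a * real (Suc k) powr (s - (a + 1))"
    by (intro always_eventually allI)
  have "filterlim (\<lambda>k. real (Suc k)) at_top sequentially"
    by (intro filterlim_compose [OF filterlim_real_sequentially] filterlim_Suc)
  then have "(\<lambda>k. real (Suc k) powr (s - (a + 1))) \<longlonglongrightarrow> 0"
    using assms by (intro tendsto_neg_powr) auto
  then show "(\<lambda>k. a * real (Suc k) powr (s - (a + 1))) \<longlonglongrightarrow> 0"
    by (rule tendsto_mult_right_zero)
qed

lemma not_summable_inverse_powr:
  fixes a K :: real
  assumes "a \<le> 1" "K > 0"
  shows "\<not> summable (\<lambda>k. K / real (Suc k) powr a)"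
proof
  assume "summable (\<lambda>k. K / real (Suc k) powr a)"
  then have "summable (\<lambda>k. inverse K * (K / real (Suc k) powr a))"
    by (rule summable_mult)
  then have "summable (\<lambda>k. inverse (real (Suc k)))"
  proof (rule summable_comparison_test' [where N = 0])
    fix k
    have "real (Suc k) powr a \<le> real (Suc k) powr 1"
      using assms by (intro powr_mono) auto
    then show "norm (inverse (real (Suc k))) \<le> inverse K * (K / real (Suc k) powr a)"
      using assms by (simp add: field_simps)
  qed
  then show False
    using not_summable_harmonic [where 'a = real] summable_Suc_iff [of "\<lambda>k. inverse (real k)"]
    by simp
qed

section \<open>Convex functions with Lipschitz gradient\<close>

text \<open>Restricting \<open>f\<close> to the line through \<open>x\<close> and \<open>y\<close>
  reduces this to the tangent inequality for convex functions of one real variable, at parameter 0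
  and evaluated at 1.\<close>

lemma convex_above_gradient:
  fixes f :: "'a::real_inner \<Rightarrow> real"
  assumes convex: "convex_on UNIV f" and grad: "GDERIV f x :> g"
  shows "f x + inner (y - x) g \<le> f y"
proof -
  define \<phi> where "\<phi> = (\<lambda>t::real. f (x + t *\<^sub>R (y - x)))"
  have "convex_on UNIV \<phi>"
  proof (rule convex_onI)
    fix t a b :: real
    assume t: "0 < t" "t < 1"
    have "x + ((1 - t) *\<^sub>R a + t *\<^sub>R b) *\<^sub>R (y - x)
        = (1 - t) *\<^sub>R (x + a *\<^sub>R (y - x)) + t *\<^sub>R (x + b *\<^sub>R (y - x))"
      by (simp add: algebra_simps)
    then show "\<phi> ((1 - t) *\<^sub>R a + t *\<^sub>R b) \<le> (1 - t) * \<phi> a + t * \<phi> b"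
      unfolding \<phi>_def using convex_onD [OF convex, of t] t by simp
  qed simp
  moreover have "(\<phi> has_real_derivative inner (y - x) g) (at 0)"
  proof -
    \<comment> \<open>The base point is written as the value at 0 of the affine parametrization, as
      the chain rule expects it.\<close>
    have f: "(f has_derivative (\<lambda>h. inner h g)) (at (x + 0 *\<^sub>R (y - x)))"
      using grad by (simp add: gderiv_def)
    have "((\<lambda>t. x + t *\<^sub>R (y - x)) has_derivative (\<lambda>t. t *\<^sub>R (y - x))) (at 0)"
      by (auto intro!: derivative_eq_intros)
    from has_derivative_compose [OF this f] show ?thesis
      by (simp add: \<phi>_def has_field_derivative_def mult_commute_abs)
  qed
  ultimately have "inner (y - x) g * (1 - 0) \<le> \<phi> 1 - \<phi> 0"
    by (intro convex_on_imp_above_tangent [where A = UNIV]) auto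
  then show ?thesis
    by (simp add: \<phi>_def)
qed

text \<open>The Baillon--Haddad inequality with half of its optimal constant, which suffices here and
  avoids integrating the gradient.\<close>

lemma gradient_cocoercive:
  fixes f :: "'a::real_inner \<Rightarrow> real"
  assumes convex: "convex_on UNIV f" and grad: "\<And>y. GDERIV f y :> g y"
    and lip: "M-lipschitz_on UNIV g" and M: "M > 0"
  shows "(norm (g x - g y))\<^sup>2 \<le> 2 * M * inner (g x - g y) (x - y)"
proof -
  have tangent: "f a + inner (b - a) (g a) \<le> f b" for a b
    by (rule convex_above_gradient [OF convex grad])
  have lower: "f x + inner (y - x) (g x) + (norm (g y - g x))\<^sup>2 / (4 * M) \<le> f y" for x y
  proof -
    define h where "h = g y - g x"
    \<comment> \<open>Going from \<open>y\<close> to \<open>w = y - s *\<^sub>R h\<close>, the two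
      tangent inequalities together gain \<open>s * (1 - M * s) * (norm h)\<^sup>2\<close>. This is
      largest at \<open>s = 1 / (2 * M)\<close>, with value
      \<open>(norm h)\<^sup>2 / (4 * M)\<close>.\<close>
    define s where "s = 1 / (2 * M)"
    define w where "w = y - s *\<^sub>R h"
    have s: "s > 0"
      using M by (simp add: s_def)
    have "norm (g y - g w) \<le> M * norm (y - w)"
      using lipschitz_onD [OF lip, of y w] by (simp add: dist_norm)
    also have "\<dots> = M * s * norm h"
      using s by (simp add: w_def)
    also have "\<dots> = norm h / 2"
      using M by (simp add: s_def)
    finally have "inner (g y - g w) h \<le> norm h / 2 * norm h"
      by (meson norm_cauchy_schwarz mult_right_mono norm_ge_zero order_trans)
    then have "inner h (g y) \<le> inner h (g w) + (norm h)\<^sup>2 / 2"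
      by (simp add: inner_commute inner_diff_right power2_eq_square)
    then have *: "s * inner h (g y) \<le> s * (inner h (g w) + (norm h)\<^sup>2 / 2)"
      using s by (intro mult_left_mono) auto
    have "f w + s * inner h (g w) \<le> f y"
      using tangent [of w y] by (simp add: w_def)
    moreover have "f x + inner (y - x) (g x) - s * inner h (g x) \<le> f w"
      using tangent [of x w] by (simp add: w_def inner_diff_left algebra_simps)
    moreover have "inner h (g y) - inner h (g x) = (norm h)\<^sup>2"
      by (simp add: h_def inner_diff_right [symmetric] power2_norm_eq_inner)
    then have "s * inner h (g y) - s * inner h (g x) = s * (norm h)\<^sup>2"
      by (metis right_diff_distrib)
    ultimately have "f x + inner (y - x) (g x) + s * (norm h)\<^sup>2 / 2 \<le> f y"
      using * by (simp add: distrib_left)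
    then show ?thesis
      by (simp add: s_def h_def)
  qed
  \<comment> \<open>Adding the bound to its copy with \<open>x\<close> and \<open>y\<close>
    exchanged cancels the function values.\<close>
  have "(norm (g x - g y))\<^sup>2 / (2 * M) \<le> inner (g x - g y) (x - y)"
    using lower [of x y] lower [of y x]
    by (simp add: norm_minus_commute inner_diff_left inner_diff_right inner_commute)
  then show ?thesis
    using M by (simp add: field_simps)
qed

text \<open>In the expansion of the squared norm, cocoercivity lets the cross term absorb
  \<open>t\<^sup>2 * (norm G)\<^sup>2\<close>. The range \<open>t \<le> 1 / M\<close> corresponds to
  the halved constant in \<open>gradient_cocoercive\<close>.\<close>

lemma gradient_step_nonexpansive:
  fixes f :: "'a::real_inner \<Rightarrow> real"
  assumes convex: "convex_on UNIV f" and grad: "\<And>y. GDERIV f y :> g y"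
    and lip: "M-lipschitz_on UNIV g" and M: "M > 0"
    and t: "0 \<le> t" "t \<le> 1 / M"
  shows "norm ((x - t *\<^sub>R g x) - (y - t *\<^sub>R g y)) \<le> norm (x - y)"
proof -
  define G where "G = g x - g y"
  define D where "D = x - y"
  have co: "(norm G)\<^sup>2 \<le> 2 * M * inner G D"
    unfolding G_def D_def by (rule gradient_cocoercive [OF convex grad lip M])
  have "M * t \<le> 1"
    using t M by (simp add: field_simps)
  then have "t * (M * t) * (norm G)\<^sup>2 \<le> t * 1 * (norm G)\<^sup>2"
    using t by (intro mult_left_mono mult_right_mono) auto
  also have "\<dots> \<le> t * (2 * M * inner G D)"
    using co t by (auto intro: mult_left_mono)
  finally have "M * (t\<^sup>2 * (norm G)\<^sup>2) \<le> M * (2 * t * inner G D)"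
    by (simp add: power2_eq_square algebra_simps)
  then have "t\<^sup>2 * (norm G)\<^sup>2 \<le> 2 * t * inner G D"
    using M by simp
  moreover have "(norm (D - t *\<^sub>R G))\<^sup>2 = (norm D)\<^sup>2 - 2 * t * inner G D + t\<^sup>2 * (norm G)\<^sup>2"
    unfolding power2_norm_eq_inner
    by (simp add: inner_diff_left inner_diff_right inner_commute power2_eq_square)
  ultimately have "(norm (D - t *\<^sub>R G))\<^sup>2 \<le> (norm D)\<^sup>2"
    by simp
  then have "norm (D - t *\<^sub>R G) \<le> norm D"
    by simp
  then show ?thesis
    by (simp add: D_def G_def algebra_simps)
qed

section \<open>The averaged step and its fixed points\<close>

text \<open>When \<open>g\<close> is the gradient of \<open>f\<close>, the vector
  \<open>g y + \<mu> *\<^sub>R y\<close> is the gradient of the Tikhonov regularization of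
  \<open>f\<close> with the penalty \<open>\<mu> / 2 * (norm y)\<^sup>2\<close>.\<close>

definition averaged_step ::
  "('a::real_normed_vector \<Rightarrow> 'a) \<Rightarrow> ('a \<Rightarrow> 'a) \<Rightarrow> real \<Rightarrow> real \<Rightarrow> real \<Rightarrow> 'a \<Rightarrow> 'a"
  where "averaged_step g T \<gamma> \<beta> \<mu> y =
    \<beta> *\<^sub>R (y - \<gamma> *\<^sub>R (g y + \<mu> *\<^sub>R y)) + (1 - \<beta>) *\<^sub>R T y"

text \<open>The regularized gradient step is a gradient step of length \<open>\<gamma> / (1 - \<gamma> * \<mu>)\<close> scaled by
  \<open>1 - \<gamma> * \<mu>\<close>, which is where its contraction factor comes from.\<close>

lemma averaged_step_contraction:
  fixes f :: "'a::real_inner \<Rightarrow> real"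
  assumes convex: "convex_on UNIV f" and grad: "\<And>y. GDERIV f y :> g y"
    and lip: "M-lipschitz_on UNIV g" and M: "M > 0"
    and T: "nonexpansive T"
    and \<gamma>: "0 < \<gamma>" "\<gamma> * (M + \<mu>) \<le> 1"
    and \<beta>: "0 \<le> \<beta>" "\<beta> \<le> 1"
  shows "norm (averaged_step g T \<gamma> \<beta> \<mu> x - averaged_step g T \<gamma> \<beta> \<mu> y)
    \<le> (1 - \<beta> * \<gamma> * \<mu>) * norm (x - y)"
proof -
  define r where "r = 1 - \<gamma> * \<mu>"
  \<comment> \<open>The hypothesis \<open>\<gamma> * (M + \<mu>) \<le> 1\<close> says
    \<open>\<gamma> * M \<le> r\<close>, which is what bounds the rescaled step length
    \<open>\<gamma> / r\<close> by \<open>1 / M\<close>.\<close>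
  have \<gamma>M: "\<gamma> * M > 0" "\<gamma> * M \<le> r"
    using \<gamma> M by (auto simp: r_def distrib_left)
  then have r: "r > 0"
    by linarith
  then have \<gamma>r: "\<gamma> / r \<le> 1 / M"
    using \<gamma>M M by (simp add: field_simps)
  define S where "S y = y - (\<gamma> / r) *\<^sub>R g y" for y
  have step: "averaged_step g T \<gamma> \<beta> \<mu> y = \<beta> *\<^sub>R r *\<^sub>R S y + (1 - \<beta>) *\<^sub>R T y" for y
  proof -
    have "r *\<^sub>R S y = r *\<^sub>R y - \<gamma> *\<^sub>R g y"
      using r by (simp add: S_def scaleR_diff_right)
    also have "\<dots> = y - \<gamma> *\<^sub>R (g y + \<mu> *\<^sub>R y)"
      by (simp add: r_def algebra_simps)
    finally show ?thesis
      by (simp add: averaged_step_def)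
  qed
  have "norm (averaged_step g T \<gamma> \<beta> \<mu> x - averaged_step g T \<gamma> \<beta> \<mu> y)
      = norm ((\<beta> * r) *\<^sub>R (S x - S y) + (1 - \<beta>) *\<^sub>R (T x - T y))"
    by (simp add: step algebra_simps)
  also have "\<dots> \<le> \<beta> * r * norm (S x - S y) + (1 - \<beta>) * norm (T x - T y)"
    by (rule order_trans [OF norm_triangle_ineq]) (use \<beta> r in \<open>simp add: abs_mult\<close>)
  also have "\<dots> \<le> \<beta> * r * norm (x - y) + (1 - \<beta>) * norm (x - y)"
  proof (intro add_mono mult_left_mono)
    show "norm (S x - S y) \<le> norm (x - y)"
      unfolding S_def
      by (rule gradient_step_nonexpansive [OF convex grad lip M]) (use \<gamma> r \<gamma>r in auto)
    show "norm (T x - T y) \<le> norm (x - y)"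
      using T by (simp add: nonexpansive_def)
  qed (use \<beta> r in auto)
  also have "\<dots> = (1 - \<beta> * \<gamma> * \<mu>) * norm (x - y)"
    by (simp add: r_def algebra_simps)
  finally show ?thesis .
qed

text \<open>At a fixed point \<open>y\<close>, the step is affine in \<open>\<beta>\<close> and in
  the product \<open>\<beta> * \<mu>\<close>. Only the increments of these two quantities therefore
  enter the drift of the fixed points.\<close>

lemma averaged_step_diff:
  "averaged_step g T \<gamma> \<beta> \<mu> y - averaged_step g T \<gamma> \<beta>' \<mu>' y
    = (\<beta> - \<beta>') *\<^sub>R (y - \<gamma> *\<^sub>R g y - T y) - (\<gamma> * (\<beta> * \<mu> - \<beta>' * \<mu>')) *\<^sub>R y"
  by (simp add: averaged_step_def algebra_simps)

text \<open>Pairing the fixed-point equation with \<open>y - p\<close> uses that \<open>I - T\<close> is monotone.\<close>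

lemma averaged_step_fixed_point_le:
  fixes f :: "'a::real_inner \<Rightarrow> real"
  assumes convex: "convex_on UNIV f" and grad: "\<And>y. GDERIV f y :> g y"
    and T: "nonexpansive T"
    and \<gamma>: "0 < \<gamma>" and \<beta>: "0 < \<beta>" "\<beta> \<le> 1"
    and y: "averaged_step g T \<gamma> \<beta> \<mu> y = y" and p: "p \<in> Fix T"
  shows "f y \<le> f p - \<mu> * inner y (y - p)"
proof -
  have "inner (T y - p) (y - p) \<le> norm (T y - p) * norm (y - p)"
    by (rule norm_cauchy_schwarz)
  also have "\<dots> \<le> norm (y - p) * norm (y - p)"
    using T p by (intro mult_right_mono) (auto simp: nonexpansive_def Fix_def, metis)
  also have "\<dots> = inner (y - p) (y - p)"
    by (simp add: power2_norm_eq_inner flip: power2_eq_square)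
  finally have "0 \<le> inner (y - T y) (y - p)"
    by (simp add: inner_diff_left inner_diff_right)
  then have "0 \<le> (1 - \<beta>) * inner (y - T y) (y - p)"
    using \<beta> by simp
  \<comment> \<open>This is the fixed-point equation rearranged. The common positive factor
    \<open>\<beta> * \<gamma>\<close> can then be dropped from the inequality, so the resulting
    bound does not degenerate as \<open>\<beta>\<close> tends to 0.\<close>
  also have "(1 - \<beta>) *\<^sub>R (y - T y) = - ((\<beta> * \<gamma>) *\<^sub>R (g y + \<mu> *\<^sub>R y))"
    using y by (simp add: averaged_step_def algebra_simps)
  then have "(1 - \<beta>) * inner (y - T y) (y - p) = - (\<beta> * \<gamma>) * inner (g y + \<mu> *\<^sub>R y) (y - p)"
    by (metis inner_scaleR_left inner_minus_left mult_minus_left)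
  finally have "inner (g y + \<mu> *\<^sub>R y) (y - p) \<le> 0"
    using \<beta> \<gamma> by (simp add: mult_le_0_iff)
  moreover have "f y + inner (p - y) (g y) \<le> f p"
    by (rule convex_above_gradient [OF convex grad])
  ultimately show ?thesis
    by (simp add: inner_add_left inner_diff_left inner_diff_right inner_commute algebra_simps)
qed

text \<open>Passing to the limit in the fixed-point equation only yields \<open>T l = l\<close>,
  because the gradient term vanishes with \<open>\<beta>\<close>. Minimality of \<open>l\<close>
  comes from \<open>averaged_step_fixed_point_le\<close>, where \<open>\<beta>\<close> has already
  been divided out.\<close>

lemma averaged_step_fixed_points_tendsto:
  fixes f :: "'a::euclidean_space \<Rightarrow> real" and u :: "nat \<Rightarrow> 'a"
  assumes convex: "convex_on UNIV f" and grad: "\<And>y. GDERIV f y :> g y"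
    and g: "continuous_on UNIV g" and T: "nonexpansive T"
    and \<gamma>: "0 < \<gamma>" and \<beta>: "\<And>k. 0 < \<beta> k" "\<And>k. \<beta> k \<le> 1"
    and \<beta>0: "\<beta> \<longlonglongrightarrow> 0" and \<mu>0: "\<mu> \<longlonglongrightarrow> 0"
    and u: "\<And>k. averaged_step g T \<gamma> (\<beta> k) (\<mu> k) (u k) = u k"
    and bounded: "bounded (range u)"
    and unique: "\<And>y. is_arg_min f (\<lambda>y. y \<in> Fix T) y \<longleftrightarrow> y = zbar"
  shows "u \<longlonglongrightarrow> zbar"
proof (rule bounded_unique_cluster_point_imp_tendsto [OF bounded])
  fix r l
  assume r: "strict_mono r" and l: "(u \<circ> r) \<longlonglongrightarrow> l"
  have ur: "(\<lambda>k. u (r k)) \<longlonglongrightarrow> l"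
    using l by (simp add: comp_def)
  have \<beta>r: "(\<lambda>k. \<beta> (r k)) \<longlonglongrightarrow> 0" and \<mu>r: "(\<lambda>k. \<mu> (r k)) \<longlonglongrightarrow> 0"
    using LIMSEQ_subseq_LIMSEQ [OF \<beta>0 r] LIMSEQ_subseq_LIMSEQ [OF \<mu>0 r]
    by (simp_all add: comp_def)
  have gl: "(\<lambda>k. g (u (r k))) \<longlonglongrightarrow> g l"
    by (rule continuous_on_tendsto_compose [OF g ur]) auto
  have "1-lipschitz_on UNIV T"
    using T by (auto simp: lipschitz_on_def nonexpansive_def dist_norm)
  then have "continuous_on UNIV T"
    by (rule lipschitz_on_continuous_on)
  then have Tl: "(\<lambda>k. T (u (r k))) \<longlonglongrightarrow> T l"
    by (rule continuous_on_tendsto_compose [OF _ ur]) auto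
  have "(\<lambda>k. averaged_step g T \<gamma> (\<beta> (r k)) (\<mu> (r k)) (u (r k)))
      \<longlonglongrightarrow> averaged_step g T \<gamma> 0 0 l"
    unfolding averaged_step_def by (intro tendsto_intros \<beta>r \<mu>r ur gl Tl)
  moreover have "averaged_step g T \<gamma> 0 0 l = T l"
    by (simp add: averaged_step_def)
  ultimately have "(\<lambda>k. u (r k)) \<longlonglongrightarrow> T l"
    by (simp only: u)
  from LIMSEQ_unique [OF this ur] have "l \<in> Fix T"
    by (simp add: Fix_def)
  moreover have "f l \<le> f p" if p: "p \<in> Fix T" for p
  proof -
    have "continuous_on UNIV f"
      by (rule has_derivative_continuous_on)
        (rule has_derivative_at_withinI [OF grad [unfolded gderiv_def]])
    then have "(\<lambda>k. f (u (r k))) \<longlonglongrightarrow> f l"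
      by (rule continuous_on_tendsto_compose [OF _ ur]) auto
    moreover have "(\<lambda>k. f p - \<mu> (r k) * inner (u (r k)) (u (r k) - p))
        \<longlonglongrightarrow> f p - 0 * inner l (l - p)"
      by (intro tendsto_intros \<mu>r ur)
    moreover have "f (u (r k)) \<le> f p - \<mu> (r k) * inner (u (r k)) (u (r k) - p)" for k
      using averaged_step_fixed_point_le [OF convex grad T \<gamma> \<beta> u p] .
    ultimately have "f l \<le> f p - 0 * inner l (l - p)"
      by (intro LIMSEQ_le) auto
    then show ?thesis
      by simp
  qed
  ultimately have "is_arg_min f (\<lambda>y. y \<in> Fix T) l"
    unfolding is_arg_min_def not_less [symmetric] by blast
  then show "l = zbar"
    by (rule unique [THEN iffD1])
qed

section \<open>Convergence of the iteration by tracking the fixed points\<close>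

theorem theorem4:
  fixes \<alpha> :: real and \<sigma> :: "real \<Rightarrow> real" and L :: nat and n :: "nat \<Rightarrow> nat"
    and W :: "nat \<Rightarrow> nat \<Rightarrow> real ^ 'm" and U :: "nat \<Rightarrow> nat \<Rightarrow> real ^ 'd"
    and b :: "nat \<Rightarrow> nat \<Rightarrow> real" and x :: "real ^ 'd"
    and T :: "real ^ 'm \<Rightarrow> real ^ 'm"
    and R :: "real ^ 'm \<Rightarrow> real" and gradR :: "real ^ 'm \<Rightarrow> real ^ 'm"
    and L\<^sub>z \<gamma> B \<rho> c \<eta> :: real and \<beta> lam :: "nat \<Rightarrow> real"
    and zbar :: "real ^ 'm" and z :: "nat \<Rightarrow> real ^ 'm"
  assumes "0 < \<alpha>" and "\<alpha> \<le> 1" and "1 \<le> L"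
    and T: "T = deep_opteq \<alpha> \<sigma> n W U b x L"
    and "nonexpansive T"
    and "convex_on UNIV R"
    and gradR: "\<And>y. GDERIV R y :> gradR y"
    and "L\<^sub>z > 0"
    and "L\<^sub>z-lipschitz_on UNIV gradR"
    and "\<gamma> = 1 / (2 * L\<^sub>z)"
    and bounded: "\<And>\<beta>' lam' y. \<lbrakk>\<beta>' \<in> {0..1/2}; lam' \<in> {0..L\<^sub>z / 2};
        y = \<beta>' *\<^sub>R (y - \<gamma> *\<^sub>R (gradR y + lam' *\<^sub>R y)) + (1 - \<beta>') *\<^sub>R T y\<rbrakk> \<Longrightarrow> norm y \<le> B"
    and unique_minimizer: "\<And>y. is_arg_min R (\<lambda>y. y \<in> Fix T) y \<longleftrightarrow> y = zbar"
    and "\<rho> > 0" and "c > 0" and "\<rho> + 2 * c < 1"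
    and "\<eta> = Min {sqrt (2 * L\<^sub>z), L\<^sub>z / 2, 1 / 2}"
    and "\<And>k. k \<ge> 1 \<Longrightarrow> \<beta> k = \<eta> / real k powr \<rho>"
    and "\<And>k. k \<ge> 1 \<Longrightarrow> lam k = \<eta> / real k powr c"
    and iteration: "\<And>k. k \<ge> 1 \<Longrightarrow>
        z k = \<beta> k *\<^sub>R ((1 - \<gamma> * lam k) *\<^sub>R z (k - 1) - \<gamma> *\<^sub>R gradR (z (k - 1)))
          + (1 - \<beta> k) *\<^sub>R T (z (k - 1))"
  shows "z \<longlonglongrightarrow> zbar"
proof -
  \<comment> \<open>The schedules start at index 1; shifting them gives
    \<open>z (Suc k) = F k (z k)\<close> for every \<open>k\<close>, including 0.\<close>
  define \<beta>' where "\<beta>' k = \<beta> (Suc k)" for k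
  define \<mu> where "\<mu> k = lam (Suc k)" for k
  define F where "F k = averaged_step gradR T \<gamma> (\<beta>' k) (\<mu> k)" for k
  define q where "q k = \<beta>' k * \<gamma> * \<mu> k" for k
  note T_nonexp = \<open>nonexpansive T\<close> and convex = \<open>convex_on UNIV R\<close>
    and Lz = \<open>L\<^sub>z > 0\<close> and lip = \<open>L\<^sub>z-lipschitz_on UNIV gradR\<close>
    and \<gamma>_def = \<open>\<gamma> = 1 / (2 * L\<^sub>z)\<close> and exponents = \<open>\<rho> > 0\<close> \<open>c > 0\<close> \<open>\<rho> + 2 * c < 1\<close>
  have \<gamma>: "\<gamma> > 0" "\<gamma> * L\<^sub>z = 1 / 2"
    using Lz by (simp_all add: \<gamma>_def)
  \<comment> \<open>The bounds \<open>1 / 2\<close> and \<open>L\<^sub>z / 2\<close> on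
    \<open>\<eta>\<close> keep all parameters in the ranges for which solutions are assumed to be
    bounded by \<open>B\<close>.\<close>
  have \<eta>: "\<eta> > 0" "\<eta> \<le> L\<^sub>z / 2" "\<eta> \<le> 1 / 2"
    using Lz \<open>\<eta> = Min _\<close> by auto
  have \<beta>'_eq: "\<beta>' k = \<eta> / real (Suc k) powr \<rho>" for k
    unfolding \<beta>'_def by (rule assms) simp
  have \<mu>_eq: "\<mu> k = \<eta> / real (Suc k) powr c" for k
    unfolding \<mu>_def by (rule assms) simp
  have le_\<eta>: "\<eta> / real (Suc k) powr s \<le> \<eta>" if "s > 0" for k s
    using \<eta> that ge_one_powr_ge_zero [of "real (Suc k)" s] by (simp add: divide_le_eq)
  have \<beta>': "0 < \<beta>' k" "\<beta>' k \<le> 1 / 2" for k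
    using \<eta> le_\<eta> [OF \<open>\<rho> > 0\<close>, of k] unfolding \<beta>'_eq
    by (simp, linarith)
  have \<beta>'1: "\<beta>' k \<le> 1" for k
    using \<beta>' [of k] by linarith
  have \<mu>: "0 < \<mu> k" "\<mu> k \<le> L\<^sub>z / 2" for k
    using \<eta> le_\<eta> [OF \<open>c > 0\<close>, of k] unfolding \<mu>_eq
    by (simp, linarith)
  \<comment> \<open>Together with \<open>\<gamma> * L\<^sub>z = 1 / 2\<close> this gives
    \<open>\<gamma> * (L\<^sub>z + \<mu> k) \<le> 3 / 4\<close>, enough for
    \<open>averaged_step_contraction\<close>.\<close>
  have \<gamma>\<mu>: "\<gamma> * \<mu> k \<le> 1 / 4" for k
    using mult_left_mono [OF \<mu>(2), of \<gamma> k] \<gamma> by simp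
  have \<beta>'\<mu>: "\<beta>' k * \<mu> k = \<eta>\<^sup>2 / real (Suc k) powr (\<rho> + c)" for k
    by (simp add: \<beta>'_eq \<mu>_eq powr_add power2_eq_square)
  have q_eq: "q k = \<gamma> * \<eta>\<^sup>2 / real (Suc k) powr (\<rho> + c)" for k
    using \<beta>'\<mu> [of k] by (simp add: q_def algebra_simps)
  have q: "0 < q k" "q k < 1" for k
  proof -
    show "0 < q k"
      using \<beta>' \<gamma> \<mu> by (simp add: q_def)
    have "q k \<le> 1 * (\<gamma> * \<mu> k)"
      using \<beta>'1 [of k] \<gamma> \<mu> [of k] unfolding q_def mult.assoc by (intro mult_right_mono) auto
    then show "q k < 1"
      using \<gamma>\<mu> [of k] by linarith
  qed
  have contraction: "norm (F k x - F k y) \<le> (1 - q k) * norm (x - y)" for k x y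
    unfolding F_def q_def
    by (rule averaged_step_contraction [OF convex gradR lip Lz T_nonexp \<gamma>(1)])
      (use \<gamma> \<gamma>\<mu> [of k] \<beta>' [of k] \<beta>'1 [of k] in \<open>auto simp: distrib_left\<close>)
  have "\<exists>y. F k y = y" for k
    using banach_fix_type [of "1 - q k" "F k"] contraction [of k] q [of k]
    by (auto simp: dist_norm)
  then obtain u where u: "\<And>k. F k (u k) = u k"
    by metis
  have u_le: "norm (u k) \<le> B" for k
  proof (rule bounded)
    show "u k = \<beta>' k *\<^sub>R (u k - \<gamma> *\<^sub>R (gradR (u k) + \<mu> k *\<^sub>R u k)) + (1 - \<beta>' k) *\<^sub>R T (u k)"
      using u [of k] by (simp add: F_def averaged_step_def)
  qed (use \<beta>' [of k] \<mu> [of k] in auto)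
  have g_cont: "continuous_on UNIV gradR"
    using lip by (rule lipschitz_on_continuous_on)
  have T_cont: "continuous_on UNIV T"
    using T_nonexp
    by (intro lipschitz_on_continuous_on [of 1])
      (auto simp: lipschitz_on_def nonexpansive_def dist_norm)
  have u_lim: "u \<longlonglongrightarrow> zbar"
  proof (rule averaged_step_fixed_points_tendsto
      [OF convex gradR g_cont T_nonexp \<gamma>(1) \<beta>'(1) \<beta>'1 _ _ _ _ unique_minimizer])
    show "\<beta>' \<longlonglongrightarrow> 0"
      unfolding \<beta>'_eq using exponents by real_asymp
    show "\<mu> \<longlonglongrightarrow> 0"
      unfolding \<mu>_eq using exponents by real_asymp
    show "bounded (range u)"
      using u_le by (auto simp: bounded_iff)
    show "averaged_step gradR T \<gamma> (\<beta>' k) (\<mu> k) (u k) = u k" for k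
      using u [of k] by (simp only: F_def)
  qed

  \<comment> \<open>This is the vector that multiplies the increment of \<open>\<beta>\<close> in
    \<open>averaged_step_diff\<close>. It is bounded because \<open>u\<close> converges and both
    \<open>gradR\<close> and \<open>T\<close> are continuous.\<close>
  define v where "v k = u k - \<gamma> *\<^sub>R gradR (u k) - T (u k)" for k
  have "v \<longlonglongrightarrow> zbar - \<gamma> *\<^sub>R gradR zbar - T zbar"
    unfolding v_def
    by (intro tendsto_intros u_lim continuous_on_tendsto_compose [OF g_cont u_lim]
        continuous_on_tendsto_compose [OF T_cont u_lim]) auto
  then have "Bseq v"
    by (intro convergent_imp_Bseq convergentI)
  then obtain V where V: "\<And>k. norm (v k) \<le> V"
    by (auto simp: Bseq_def)
  define \<Delta> where "\<Delta> s k = 1 / real (Suc k) powr s - 1 / real (Suc (Suc k)) powr s" for s k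
  have \<Delta>: "0 \<le> \<Delta> s k" if "s > 0" for s k
    using that by (auto simp: \<Delta>_def intro!: divide_left_mono powr_mono2)
  define d where "d k = norm (u k - u (Suc k))" for k
  \<comment> \<open>Both maps are compared at \<open>u (Suc k)\<close>. The contraction part
    contributes \<open>(1 - q k) * d k\<close>, which moves to the left; the rest is the change of
    parameters.\<close>
  have qd: "q k * d k \<le> \<eta> * V * \<Delta> \<rho> k + \<gamma> * \<eta>\<^sup>2 * B * \<Delta> (\<rho> + c) k" for k
  proof -
    let ?y = "u (Suc k)"
    have "u k - ?y = (F k (u k) - F k ?y) + (F k ?y - F (Suc k) ?y)"
      by (simp add: u)
    then have "d k \<le> norm (F k (u k) - F k ?y) + norm (F k ?y - F (Suc k) ?y)"
      unfolding d_def by (metis norm_triangle_ineq)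
    then have "q k * d k \<le> norm (F k ?y - F (Suc k) ?y)"
      using contraction [of k "u k" ?y] by (simp add: d_def algebra_simps)
    also have "F k ?y - F (Suc k) ?y
        = (\<eta> * \<Delta> \<rho> k) *\<^sub>R v (Suc k) - (\<gamma> * (\<eta>\<^sup>2 * \<Delta> (\<rho> + c) k)) *\<^sub>R ?y"
    proof -
      have "\<beta>' k - \<beta>' (Suc k) = \<eta> * \<Delta> \<rho> k"
        by (simp add: \<beta>'_eq \<Delta>_def algebra_simps)
      moreover have "\<beta>' k * \<mu> k - \<beta>' (Suc k) * \<mu> (Suc k) = \<eta>\<^sup>2 * \<Delta> (\<rho> + c) k"
        unfolding \<beta>'\<mu> by (simp add: \<Delta>_def algebra_simps)
      ultimately show ?thesis
        unfolding F_def averaged_step_diff v_def by simp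
    qed
    also have "norm \<dots> \<le> norm ((\<eta> * \<Delta> \<rho> k) *\<^sub>R v (Suc k))
        + norm ((\<gamma> * (\<eta>\<^sup>2 * \<Delta> (\<rho> + c) k)) *\<^sub>R ?y)"
      by (rule norm_triangle_ineq4)
    also have "\<dots> = \<eta> * \<Delta> \<rho> k * norm (v (Suc k)) + \<gamma> * \<eta>\<^sup>2 * \<Delta> (\<rho> + c) k * norm ?y"
      using \<eta> \<gamma> \<Delta> [of \<rho> k] \<Delta> [of "\<rho> + c" k] exponents by (simp add: abs_mult)
    also have "\<dots> \<le> \<eta> * \<Delta> \<rho> k * V + \<gamma> * \<eta>\<^sup>2 * \<Delta> (\<rho> + c) k * B"
      using \<eta> \<gamma> \<Delta> [of \<rho> k] \<Delta> [of "\<rho> + c" k] exponents V [of "Suc k"] u_le [of "Suc k"]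
      by (intro add_mono mult_left_mono) auto
    finally show ?thesis
      by (simp add: algebra_simps)
  qed
  \<comment> \<open>Since \<open>d k / q k = (q k * d k) / (q k)\<^sup>2\<close>, the bound
    \<open>qd\<close> has to beat the growth of \<open>1 / (q k)\<^sup>2\<close>, which is
    \<open>w k\<close> up to a constant.\<close>
  define w where "w k = real (Suc k) powr (2 * \<rho> + 2 * c)" for k
  have w: "1 / (q k)\<^sup>2 = w k / (\<gamma> * \<eta>\<^sup>2)\<^sup>2" for k
  proof -
    have "w k = (real (Suc k) powr (\<rho> + c))\<^sup>2"
      by (simp add: w_def power2_eq_square powr_add [symmetric])
    then show ?thesis
      by (simp add: q_eq power_divide)
  qed
  have drift: "(\<lambda>k. d k / q k) \<longlonglongrightarrow> 0"
  proof (rule tendsto_sandwich [OF _ _ tendsto_const])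
    show "\<forall>\<^sub>F k in sequentially. 0 \<le> d k / q k"
      using q by (simp add: d_def less_imp_le)
    have "d k / q k \<le> (\<eta> * V * (\<Delta> \<rho> k * w k) + \<gamma> * \<eta>\<^sup>2 * B * (\<Delta> (\<rho> + c) k * w k))
        / (\<gamma> * \<eta>\<^sup>2)\<^sup>2" for k
    proof -
      have "d k / q k = (q k * d k) * (1 / (q k)\<^sup>2)"
        using q(1) [of k] by (simp add: power2_eq_square)
      also have "\<dots> \<le> (\<eta> * V * \<Delta> \<rho> k + \<gamma> * \<eta>\<^sup>2 * B * \<Delta> (\<rho> + c) k) * (1 / (q k)\<^sup>2)"
        by (intro mult_right_mono qd) simp
      finally show ?thesis
        by (simp only: w times_divide_eq_right distrib_right mult.assoc)
    qed
    then show "\<forall>\<^sub>F k in sequentially. d k / q k \<le>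
        (\<eta> * V * (\<Delta> \<rho> k * w k) + \<gamma> * \<eta>\<^sup>2 * B * (\<Delta> (\<rho> + c) k * w k)) / (\<gamma> * \<eta>\<^sup>2)\<^sup>2"
      by simp
    \<comment> \<open>The first limit requires \<open>2 * \<rho> + 2 * c < \<rho> + 1\<close>, that
      is \<open>\<rho> + 2 * c < 1\<close>; the second requires only
      \<open>\<rho> + c < 1\<close>.\<close>
    have "(\<lambda>k. \<Delta> \<rho> k * w k) \<longlonglongrightarrow> 0" "(\<lambda>k. \<Delta> (\<rho> + c) k * w k) \<longlonglongrightarrow> 0"
      unfolding \<Delta>_def w_def by (rule powr_difference_tendsto_0; use exponents in simp)+
    from tendsto_divide_zero [OF tendsto_add_zero [OF tendsto_mult_right_zero [OF this(1)]
        tendsto_mult_right_zero [OF this(2)]]]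
    show "(\<lambda>k. (\<eta> * V * (\<Delta> \<rho> k * w k) + \<gamma> * \<eta>\<^sup>2 * B * (\<Delta> (\<rho> + c) k * w k))
        / (\<gamma> * \<eta>\<^sup>2)\<^sup>2) \<longlonglongrightarrow> 0" .
  qed
  have div: "\<not> summable q"
    unfolding q_eq using exponents \<gamma> \<eta> by (intro not_summable_inverse_powr) auto
  have track: "norm (z (Suc k) - u (Suc k)) \<le> (1 - q k) * norm (z k - u k) + d k" for k
  proof -
    have "z (Suc k) = F k (z k)"
      using iteration [of "Suc k"]
      by (simp add: F_def averaged_step_def \<beta>'_def \<mu>_def algebra_simps)
    then have "z (Suc k) - u (Suc k) = (F k (z k) - F k (u k)) + (u k - u (Suc k))"
      by (simp add: u)
    then have "norm (z (Suc k) - u (Suc k)) \<le> norm (F k (z k) - F k (u k)) + d k"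
      unfolding d_def by (metis norm_triangle_ineq)
    then show ?thesis
      using contraction [of k "z k" "u k"] by linarith
  qed
  have "(\<lambda>k. norm (z k - u k)) \<longlonglongrightarrow> 0"
    by (rule perturbed_contraction_tendsto_0
        [OF norm_ge_zero q(1) less_imp_le [OF q(2)] div drift track])
  then have "(\<lambda>k. z k - u k) \<longlonglongrightarrow> 0"
    by (rule tendsto_norm_zero_cancel)
  from tendsto_add [OF this u_lim] show ?thesis
    by simp
qed

end
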